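(* Let $\mathbb{B}^2$ be the open unit disk in the plane, let $a\in\mathbb{B}^2$, and let $h$ be a Möbius transformation mapping $\mathbb{B}^2\setminus\{0\}$ onto $\mathbb{B}^2\setminus\{a\}$ with $h(0)=a$. Then for all $x,y\in\mathbb{B}^2\setminus\{0\}$ $$ j_{\mathbb{B}^2\setminus\{a\}}(h(x),h(y))\le C(a)\, j_{\mathbb{B}^2\setminus\{0\}}(x,y),\qquad\text{where } C(a)=1+\frac{\log\frac{2+|a|}{2-|a|}}{\log 3}, $$ and the constant $C(a)$ is best possible (i.e. it cannot be replaced by any smaller constant).
   Context: For a proper subdomain $G\subset\mathbb{R}^n$ and $x,y\in G$, the distance ratio metric is $$ j_G(x,y)=\log\left(1+\frac{|x-y|}{\min\{d_G(x),d_G(y)\}}\right), $$ where $d_G(x)$ denotes the Euclidean distance from $x$ to the boundary $\partial G$. In particular, for $G=\mathbb{B}^2\setminus\{p\}$ with $p\in\mathbb{B}^2$, one has $d_G(x)=\min\{|x-p|,\,1-|x|\}$. The condition $h(0)=a$ refers to the Möbius transformation $h$ as a map defined on all of $\mathbb{B}^2$ (thus $h$ maps $\mathbb{B}^2$ onto $\mathbb{B}^2$). *)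

theory Defs
  imports "HOL-Analysis.Analysis"
begin

definition distance_ratio :: "'a::euclidean_space set \<Rightarrow> 'a \<Rightarrow> 'a \<Rightarrow> real" where
  "distance_ratio G x y =
     ln (1 + dist x y / min (infdist x (frontier G)) (infdist y (frontier G)))"

(* Moebius transformations of the plane, in the sense of the group generated by
   reflections in circles and lines: the second disjunct gives the
   orientation-reversing maps. Only the values of h on S matter, and h has no
   pole in S. *)
definition moebius_on :: "complex set \<Rightarrow> (complex \<Rightarrow> complex) \<Rightarrow> bool" where
  "moebius_on S h \<longleftrightarrow>
     (\<exists>\<alpha> \<beta> \<gamma> \<delta>. \<alpha> * \<delta> - \<beta> * \<gamma> \<noteq> 0 \<and>
        ((\<forall>z\<in>S. \<gamma> * z + \<delta> \<noteq> 0 \<and> h z = (\<alpha> * z + \<beta>) / (\<gamma> * z + \<delta>)) \<or>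
         (\<forall>z\<in>S. \<gamma> * cnj z + \<delta> \<noteq> 0 \<and> h z = (\<alpha> * cnj z + \<beta>) / (\<gamma> * cnj z + \<delta>))))"

definition lipschitz_bound :: "complex \<Rightarrow> real" where
  "lipschitz_bound a = 1 + ln ((2 + norm a) / (2 - norm a)) / ln 3"

end

theory Submission
  imports Defs
begin

text \<open>
  Up to a rotation or reflection \<open>h\<close> is \<open>z \<mapsto> (z + a) / (1 + cnj a * z)\<close>. Put \<open>s = |x|\<close>, \<open>t = |y|\<close>,
  \<open>R = |x - y|\<close>, let \<open>m\<close> be the smaller boundary distance of \<open>x\<close>, \<open>y\<close>, and \<open>B = R / m\<close>. By symmetry
  the smaller boundary distance of the images is attained at \<open>h x\<close>, at \<open>a\<close> or at the unit circle.
  In both cases the image quotient is at most \<open>B (2 + |a| B) / (2 - |a|)\<close> if \<open>B \<le> 2\<close>, and at most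
  \<open>B (2 + B) (1 + |a|) / (2 + B - |a| B)\<close> if \<open>B \<ge> 2\<close>. Both bounds agree with \<open>(1 + B)\<close> raised to the power \<open>C(a)\<close>
  at \<open>B = 2\<close>; elsewhere concavity gives the inequality, of \<open>(1 + B)\<close> raised to \<open>C(a) - 1\<close> for \<open>B \<le> 2\<close>, and of
  \<open>v \<mapsto> artanh (|a| tanh v)\<close> for \<open>B \<ge> 2\<close>. The pair \<open>x = u/2\<close>, \<open>y = -u/2\<close> with \<open>u = a/|a|\<close> has \<open>B = 2\<close> and
  attains equality.
\<close>

section \<open>The image quotient when the puncture is the nearest boundary point\<close>

text \<open>The case where the nearest boundary point of the image of \<open>x\<close> is the puncture.\<close>

lemma puncture_quotient_bound:
  fixes a s t R B m Y :: real
  assumes a: "0 \<le> a" "a < 1" and s: "0 < s" and t: "t < 1" and m: "m \<le> s" "m \<le> 1 - t"  "0 < m"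
   and B: "0 \<le> B" "R = B * m" and tri: "t \<le> s + R" and Y: "1 - a * t \<le> Y"
  shows "R / (s * Y) \<le> B * (2 + B) / (2 + B - a * (1 + B))"
proof -
  have "a * t \<le> a * 1" using a t by (intro mult_left_mono) auto
  then have pos: "0 < 1 - a * t" using a by simp
  have "a * (1 + B) \<le> 1 * (1 + B)" using a B by (intro mult_right_mono) auto
  then have pos2: "0 < 2 + B - a * (1 + B)" by simp
  have key: "m * (2 + B - a * (1 + B)) \<le> s * (1 - a * t) * (2 + B)"
  \<comment> \<open>At the threshold \<open>t = (1 + B) / (2 + B)\<close> the constraints
    \<open>m \<le> s\<close>, \<open>m \<le> 1 - t\<close> and \<open>t \<le> s + R\<close> can all
    be equalities, with \<open>m = 1 / (2 + B)\<close>. Below it \<open>m \<le> s\<close> suffices;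
    above it the triangle inequality keeps \<open>s\<close> at least
    \<open>1 / (2 + B)\<close>.\<close>
  proof (cases "t * (2 + B) \<le> 1 + B")
    case True
    have "a * (t * (2 + B)) \<le> a * (1 + B)" using True a by (intro mult_left_mono) auto
    then have "2 + B - a * (1 + B) \<le> (1 - a * t) * (2 + B)" by (simp add: algebra_simps)
    then have "m * (2 + B - a * (1 + B)) \<le> s * ((1 - a * t) * (2 + B))"
      using m s pos2 by (intro mult_mono) auto
    then show ?thesis by (simp add: mult.assoc)
  next
    case False
    have "B * m \<le> B * (1 - t)" using m B by (intro mult_left_mono) auto
    then have "s \<ge> t - B * (1 - t)" using tri B by simp
    then have "s * (2 + B) \<ge> (t - B * (1 - t)) * (2 + B)" using B by (intro mult_right_mono) auto
    also have "(t - B * (1 - t)) * (2 + B) = (1 + B) * (t * (2 + B)) - B * (2 + B)" by (simp add: algebra_simps)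
    also have "\<dots> \<ge> (1 + B) * (1 + B) - B * (2 + B)" using False B by (intro diff_right_mono mult_left_mono) auto
    finally have s1: "s * (2 + B) \<ge> 1" by (simp add: algebra_simps)
    have "m * (2 + B - a * (1 + B)) \<le> (1 - t) * (2 + B - a * (1 + B))"
      using m pos2 by (intro mult_right_mono) auto
    also have "\<dots> = (1 - a * t) - (1 - a) * (t * (2 + B) - (1 + B))" by (simp add: algebra_simps)
    also have "\<dots> \<le> 1 * (1 - a * t)" using False a by simp
    also have "\<dots> \<le> (s * (2 + B)) * (1 - a * t)" using s1 pos by (intro mult_right_mono) auto
    finally show ?thesis by (simp add: algebra_simps)
  qed
  have "R / (s * Y) \<le> R / (s * (1 - a * t))"
    using Y s pos B m by (intro divide_left_mono) auto
  also have "\<dots> \<le> B * (2 + B) / (2 + B - a * (1 + B))"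
    using mult_left_mono[OF key B(1)] B s pos pos2
    by (simp add: divide_simps) (simp add: algebra_simps)
  finally show ?thesis .
qed

text \<open>Brings the puncture case under the bound used for \<open>B \<le> 2\<close>: after
  cross-multiplication the gap, apart from the common factor \<open>B\<close>, is
  \<open>a * B * (1 + B) * (1 - a)\<close>.\<close>

lemma quotient_bound_le2:
  fixes a B :: real
  assumes a: "0 \<le> a" "a < 1" and B: "0 \<le> B"
  shows "B * (2 + B) / (2 + B - a * (1 + B)) \<le> B * (2 + a * B) / (2 - a)"
proof -
  have "a * (1 + B) \<le> 1 * (1 + B)" using a B by (intro mult_right_mono) auto
  then have pos2: "0 < 2 + B - a * (1 + B)" by simp
  have "0 \<le> a * B * (1 + B) * (1 - a)" using a B by simp
  then have "(2 + B) * (2 - a) \<le> (2 + a * B) * (2 + B - a * (1 + B))" by (simp add: algebra_simps)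
  from mult_left_mono[OF this B] show ?thesis using pos2 a by (simp add: divide_simps mult.assoc)
qed

text \<open>The counterpart for the bound used when \<open>B \<ge> 2\<close>; apart from the factor
  \<open>B * (2 + B)\<close> the gap is \<open>a * (1 + B) * (1 - a)\<close>.\<close>

lemma quotient_bound_ge2:
  fixes a B :: real
  assumes a: "0 \<le> a" "a < 1" and B: "0 \<le> B"
  shows "B * (2 + B) / (2 + B - a * (1 + B)) \<le> B * (2 + B) * (1 + a) / (2 + B - a * B)"
proof -
  have "a * (1 + B) \<le> 1 * (1 + B)" using a B by (intro mult_right_mono) auto
  then have pos2: "0 < 2 + B - a * (1 + B)" "0 < 2 + B - a * B" using a by (auto simp: algebra_simps)
  have "0 \<le> a * (1 + B) * (1 - a)" using a B by simp
  then have "(2 + B - a * B) \<le> (1 + a) * (2 + B - a * (1 + B))" by (simp add: algebra_simps)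
  from mult_left_mono[OF this, of "B * (2 + B)"] show ?thesis using pos2 a B by (simp add: divide_simps mult.assoc)
qed

section \<open>The image quotient when the unit circle is nearest\<close>

text \<open>
  Here \<open>q = |1 + cnj a * x|\<close>, \<open>p = |x + a|\<close>, \<open>Y = |1 + cnj a * y|\<close>, with \<open>a\<close> standing for \<open>|a|\<close>; the quotient
  bounded is the one for which the unit circle is nearest to the image of \<open>x\<close>. The square root \<open>p\<close> is
  concave in \<open>q\<close>, so it is replaced by its tangent at the largest value \<open>q = 1 + a * s\<close>.
\<close>

lemma circle_quotient_bounds:
  fixes a s t R p q Y :: real
  assumes a: "0 \<le> a" "a < 1" and s: "0 < s" "s < 1" and t: "t < 1" and R: "0 \<le> R"
   and pq: "0 \<le> p" "0 < q" "q \<le> 1 + a * s" "q\<^sup>2 - p\<^sup>2 = (1 - a\<^sup>2) * (1 - s\<^sup>2)"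
   and Y: "1 - a * t \<le> Y" "q - a * R \<le> Y"
  shows "a * R \<le> (1 - a) * (1 - s) \<Longrightarrow>
     R * (q + p) / ((1 - s\<^sup>2) * Y) \<le> R * (1 + a) / ((1 - s) * (1 + a * s - a * R))"
    and "(1 - a) * (1 - s) < a * R \<Longrightarrow>
     R * (q + p) / ((1 - s\<^sup>2) * Y) \<le> R * (1 + a) * (1 - a * t + a * R - (1 - a) * (1 - s)) / ((1 - s) * (a + s) * (1 - a * t))"
    and "R * (q + p) / ((1 - s\<^sup>2) * Y) \<le> R * (1 + a) / ((1 - s) * (1 - a * t))"
proof -
  \<comment> \<open>The tangent bound for \<open>q + p\<close> vanishes at \<open>q = c\<close>.
    Whether \<open>(q - c) / (q - a * R)\<close> increases in \<open>q\<close> is decided by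
    comparing \<open>c\<close> with \<open>a * R\<close>.\<close>
  define c where "c = (1 - a) * (1 - s)"
  have "a * t \<le> a * 1" using a t by (intro mult_left_mono) auto
  then have pos: "0 < 1 - a * t" using a by simp
  have "s\<^sup>2 < 1" using s by (simp add: power_less_one_iff)
  have s2: "1 - s\<^sup>2 = (1 - s) * (1 + s)" by (simp add: power2_eq_square algebra_simps)
  have c: "0 < c" using a s by (simp add: c_def)
  have "p\<^sup>2 \<le> (1 + a * s)\<^sup>2 - (1 - a\<^sup>2) * (1 - s\<^sup>2)"
    using pq power_mono[of q "1 + a * s" 2] by linarith
  also have "\<dots> = (a + s)\<^sup>2" by (simp add: power2_eq_square algebra_simps)
  finally have pas: "p \<le> a + s" by (rule power2_le_imp_le) (use a s in simp)
  \<comment> \<open>The tangent inequality, squared: the two squares differ by a nonnegative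
    multiple of the squared distance from \<open>q\<close> to the point of tangency.\<close>
  have "((a + s) * p)\<^sup>2 = (a + s)\<^sup>2 * (q\<^sup>2 - (1 - a\<^sup>2) * (1 - s\<^sup>2))"
    unfolding power_mult_distrib pq(4)[symmetric] by simp
  also have "\<dots> = ((1 + a * s) * q - (1 - a\<^sup>2) * (1 - s\<^sup>2))\<^sup>2 - (1 - a\<^sup>2) * (1 - s\<^sup>2) * (q - (1 + a * s))\<^sup>2"
    by (simp add: power2_eq_square algebra_simps)
  also have "\<dots> \<le> ((1 + a * s) * q - (1 - a\<^sup>2) * (1 - s\<^sup>2))\<^sup>2"
    using a s \<open>s\<^sup>2 < 1\<close> by (simp add: power_le_one)
  finally have sq: "((a + s) * p)\<^sup>2 \<le> ((1 + a * s) * q - (1 - a\<^sup>2) * (1 - s\<^sup>2))\<^sup>2" .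
  have "(1 - a\<^sup>2) * (1 - s\<^sup>2) \<le> q\<^sup>2" using pq(4) zero_le_power2[of p] by linarith
  also have "q\<^sup>2 \<le> (1 + a * s) * q" using pq by (simp add: power2_eq_square)
  finally have "0 \<le> (1 + a * s) * q - (1 - a\<^sup>2) * (1 - s\<^sup>2)" by simp
  with sq have "(a + s) * p \<le> (1 + a * s) * q - (1 - a\<^sup>2) * (1 - s\<^sup>2)"
    by (rule power2_le_imp_le)
  then have pql: "(a + s) * (q + p) \<le> (1 + a) * (1 + s) * (q - c)"
    by (simp add: c_def power2_eq_square algebra_simps)
  have "0 < (a + s) * (q + p)" using a s pq by simp
  also note pql
  finally have "0 < (1 + a) * (1 + s) * (q - c)" .
  then have qc: "0 < q - c"
    by (rule zero_less_mult_pos) (use a s in simp)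
  have Ypos: "0 < Y" using Y pos by simp
  have main: "R * (q + p) / ((1 - s\<^sup>2) * Y) \<le> R * (1 + a) * ((q - c) / Y) / ((1 - s) * (a + s))"
  proof -
    have "R * (q + p) / ((1 - s\<^sup>2) * Y) = R * ((a + s) * (q + p)) / ((1 - s\<^sup>2) * Y * (a + s))"
      using a s by (simp add: divide_simps)
    also have "\<dots> \<le> R * ((1 + a) * (1 + s) * (q - c)) / ((1 - s\<^sup>2) * Y * (a + s))"
      using pql R a s Ypos \<open>s\<^sup>2 < 1\<close> by (intro divide_right_mono mult_left_mono) auto
    also have "\<dots> = R * (1 + a) * ((q - c) / Y) / ((1 - s) * (a + s))"
      unfolding s2 using a s Ypos by (simp add: divide_simps)
    finally show ?thesis .
  qed
  show "R * (q + p) / ((1 - s\<^sup>2) * Y) \<le> R * (1 + a) / ((1 - s) * (1 + a * s - a * R))"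
    if "a * R \<le> (1 - a) * (1 - s)"
  proof -
    have le: "a * R \<le> c" using that by (simp add: c_def)
    have "(q - c) / Y \<le> (q - c) / (q - a * R)" using qc Y le by (intro divide_left_mono) auto
    \<comment> \<open>Since \<open>a * R \<le> c\<close>, the quotient increases with
      \<open>q\<close>, so the largest admissible \<open>q\<close> is inserted.\<close>
    also have "\<dots> \<le> (1 + a * s - c) / (1 + a * s - a * R)"
    proof -
      have "0 \<le> (1 + a * s - q) * (c - a * R)" using pq le by simp
      then have "(q - c) * (1 + a * s - a * R) \<le> (1 + a * s - c) * (q - a * R)" by (simp add: algebra_simps)
      then show ?thesis using qc le pq by (simp add: divide_simps)
    qed
    finally have "(q - c) / Y \<le> (a + s) / (1 + a * s - a * R)" by (simp add: c_def algebra_simps)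
    then have "R * (1 + a) * ((q - c) / Y) / ((1 - s) * (a + s)) \<le> R * (1 + a) * ((a + s) / (1 + a * s - a * R)) / ((1 - s) * (a + s))"
      using R a s by (intro divide_right_mono mult_left_mono) auto
    also have "\<dots> = R * (1 + a) / ((1 - s) * (1 + a * s - a * R))" using a s by simp
    finally show ?thesis using main by (rule order_trans[rotated])
  qed
  show "R * (q + p) / ((1 - s\<^sup>2) * Y) \<le> R * (1 + a) * (1 - a * t + a * R - (1 - a) * (1 - s)) / ((1 - s) * (a + s) * (1 - a * t))"
    if "(1 - a) * (1 - s) < a * R"
  proof -
    have le: "c < a * R" using that by (simp add: c_def)
    \<comment> \<open>Now \<open>q\<close> is eliminated through \<open>q \<le> Y + a * R\<close>;
      the result decreases in \<open>Y\<close>, so the lower bound \<open>1 - a * t\<close> is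
      inserted.\<close>
    have "(q - c) / Y \<le> (Y + (a * R - c)) / Y" using Y Ypos by (intro divide_right_mono) auto
    also have "\<dots> = 1 + (a * R - c) / Y" using Ypos by (simp add: add_divide_distrib)
    also have "\<dots> \<le> 1 + (a * R - c) / (1 - a * t)" using le Y pos by (intro add_left_mono divide_left_mono) auto
    also have "\<dots> = (1 - a * t + a * R - c) / (1 - a * t)" using pos by (simp add: field_simps)
    finally have "R * (1 + a) * ((q - c) / Y) / ((1 - s) * (a + s)) \<le> R * (1 + a) * ((1 - a * t + a * R - c) / (1 - a * t)) / ((1 - s) * (a + s))"
      using R a s by (intro divide_right_mono mult_left_mono) auto
    also have "\<dots> = R * (1 + a) * (1 - a * t + a * R - (1 - a) * (1 - s)) / ((1 - s) * (a + s) * (1 - a * t))"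
      by (simp add: c_def mult.commute)
    finally show ?thesis using main by (rule order_trans[rotated])
  qed
  \<comment> \<open>A coarser bound from the largest values of \<open>q\<close> and
    \<open>p\<close>; it is used for \<open>B \<ge> 2\<close> when
    \<open>s \<le> B / (2 + B)\<close>.\<close>
  have "q + p \<le> (1 + a) * (1 + s)" using pas pq by (simp add: algebra_simps)
  then have "R * (q + p) / ((1 - s\<^sup>2) * Y) \<le> R * ((1 + a) * (1 + s)) / ((1 - s\<^sup>2) * (1 - a * t))"
    using R a s pq Y pos \<open>s\<^sup>2 < 1\<close> by (intro frac_le mult_left_mono mult_nonneg_nonneg) auto
  also have "\<dots> = R * (1 + a) / ((1 - s) * (1 - a * t))" unfolding s2 using s pos by simp
  finally show "R * (q + p) / ((1 - s\<^sup>2) * Y) \<le> R * (1 + a) / ((1 - s) * (1 - a * t))" .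
qed

text \<open>Since \<open>t \<le> 1 - m\<close>, the left side is at most its value at \<open>t = 1 - m\<close>, which increases with \<open>m\<close>.\<close>

lemma eliminate_second_radius:
  fixes a t m \<mu> b c :: real
  assumes a: "0 \<le> a" "a < 1" and m: "0 < m" "m \<le> 1 - t" "m \<le> \<mu>" and c: "0 \<le> c" "c \<le> b * m"
  shows "m * (1 - a * t + b * m - c) / (1 - a * t) \<le> \<mu> * (1 - a + a * \<mu> + b * \<mu> - c) / (1 - a + a * \<mu>)"
proof -
  have "a * m \<le> a * (1 - t)" using m a by (intro mult_left_mono) auto
  then have d1: "1 - a + a * m \<le> 1 - a * t" by (simp add: algebra_simps)
  have dpos: "0 < 1 - a + a * m" "0 < 1 - a + a * \<mu>" using a m by (auto intro: add_pos_nonneg)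
  have pos: "0 < 1 - a * t" using d1 dpos by simp
  have b: "0 \<le> b" using c m by (smt (verit) mult_nonneg_nonpos mult_neg_pos)
  have "m * (1 - a * t + b * m - c) / (1 - a * t) = m * (1 + (b * m - c) / (1 - a * t))"
    using pos by (simp add: field_simps)
  also have "\<dots> \<le> m * (1 + (b * m - c) / (1 - a + a * m))"
    using m c d1 dpos pos by (intro mult_left_mono add_left_mono divide_left_mono) auto
  also have "\<dots> \<le> \<mu> * (1 + (b * \<mu> - c) / (1 - a + a * \<mu>))"
  proof -
    \<comment> \<open>Cross-multiplied monotonicity in \<open>m\<close>, whose sign is that of
      \<open>b * (1 - a) + c * a\<close>.\<close>
    have "0 \<le> (\<mu> - m) * (b * (1 - a) + c * a)" using m a b c by (intro mult_nonneg_nonneg add_nonneg_nonneg) auto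
    then have "(b * m - c) * (1 - a + a * \<mu>) \<le> (b * \<mu> - c) * (1 - a + a * m)" by (simp add: algebra_simps)
    then have "(b * m - c) / (1 - a + a * m) \<le> (b * \<mu> - c) / (1 - a + a * \<mu>)"
      using dpos by (simp add: divide_simps)
    then show ?thesis using c m dpos by (intro mult_mono) auto
  qed
  also have "\<dots> = \<mu> * (1 - a + a * \<mu> + b * \<mu> - c) / (1 - a + a * \<mu>)"
    using dpos by (simp add: divide_simps)
  finally show ?thesis .
qed

text \<open>\<open>A\<close> stands for the image quotient, and \<open>near\<close> and
  \<open>far\<close> are the two tangent estimates. The estimates in \<open>s\<close> and
  \<open>m\<close> are chosen to be tight at \<open>s = m = 1/2\<close>, those remaining in
  \<open>a\<close> and \<open>B\<close> at \<open>B = 2\<close>: the data of the extremal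
  pair.\<close>

lemma circle_quotient_le2:
  fixes a s t R B m A :: real
  assumes a: "0 \<le> a" "a < 1" and s: "0 < s" "s < 1" and t: "t < 1"
   and m: "0 < m" "m \<le> s" "m \<le> 1 - s" "m \<le> 1 - t"
   and B: "0 \<le> B" "B \<le> 2" "R = B * m"
   and near: "a * R \<le> (1 - a) * (1 - s) \<Longrightarrow> A \<le> R * (1 + a) / ((1 - s) * (1 + a * s - a * R))"
   and far: "(1 - a) * (1 - s) < a * R \<Longrightarrow>
     A \<le> R * (1 + a) * (1 - a * t + a * R - (1 - a) * (1 - s)) / ((1 - s) * (a + s) * (1 - a * t))"
  shows "A \<le> B * (2 + a * B) / (2 - a)"
proof -
  have "a * t \<le> a * 1" using a t by (intro mult_left_mono) auto
  then have pos: "0 < 1 - a * t" using a by simp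
  have m2: "m \<le> 1/2" using m by simp
  have aB: "a * B \<le> 2 * a" using mult_left_mono[OF B(2) a(1)] by (simp add: mult.commute)
  have aB2: "(a * B) * m \<le> (2 * a) * s"
    by (rule mult_mono) (use aB m a in auto)
  show ?thesis
  proof (cases "a * R \<le> (1 - a) * (1 - s)")
    case True
    have "a * s \<le> a * 1" using a s by (intro mult_left_mono) auto
    then have p1: "0 < 1 + a * s - a * B * m" using aB2 a by simp
    have low: "m * (2 + a - a * B) \<le> 2 * ((1 - s) * (1 + a * s - a * B * m))"
    proof (cases "1/2 \<le> s")
      case True
      have "a * B * m \<le> a * B * (1/2)" "a * (1/2) \<le> a * s"
        by (rule mult_left_mono; use m2 a B True in simp)+
      then have "(2 + a - a * B)/2 \<le> 1 + a * s - a * B * m" by simp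
      then have "m * ((2 + a - a * B)/2) \<le> (1 - s) * (1 + a * s - a * B * m)"
        using m aB a p1 by (intro mult_mono) auto
      then show ?thesis by simp
    next
      case False
      have b: "a * B * s \<le> 2 * a * s" by (rule mult_right_mono) (use aB s in auto)
      have "m * (2 + a - a * B) \<le> s * (2 + a - a * B)" using m aB a by (intro mult_right_mono) auto
      \<comment> \<open>The added term is nonnegative for \<open>s < 1/2\<close> and completes the
        expression to the right side with \<open>m\<close> replaced by \<open>s\<close>.\<close>
      also have "\<dots> \<le> s * (2 + a - a * B) + (1 - 2 * s) * (2 + a * (1 - B) * s)"
      proof -
        have "0 \<le> 2 + a * (1 - B) * s" using b \<open>a * s \<le> a * 1\<close> a s by (simp add: algebra_simps)
        then show ?thesis using False by simp
      qed
      also have "\<dots> = 2 * ((1 - s) * (1 + a * s - a * B * s))" by (simp add: algebra_simps)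
      also have "\<dots> \<le> 2 * ((1 - s) * (1 + a * s - a * B * m))"
        using m s a B by (intro mult_left_mono diff_left_mono) auto
      finally show ?thesis .
    qed
    \<comment> \<open>With \<open>s\<close> and \<open>m\<close> separated off by
      \<open>low\<close>, the remaining inequality in \<open>a\<close> and \<open>B\<close> has
      exactly this gap.\<close>
    have "0 \<le> a\<^sup>2 * (2 - B) * (1 + B)" using a B by simp
    then have "2 * (1 + a) * (2 - a) \<le> (2 + a * B) * (2 + a - a * B)"
      by (simp add: power2_eq_square algebra_simps)
    then have "m * (2 * (1 + a) * (2 - a)) \<le> m * ((2 + a * B) * (2 + a - a * B))"
      using m by (intro mult_left_mono) auto
    also have "\<dots> = (2 + a * B) * (m * (2 + a - a * B))" by simp
    also have "\<dots> \<le> (2 + a * B) * (2 * ((1 - s) * (1 + a * s - a * B * m)))"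
      using low a B by (intro mult_left_mono) auto
    finally have "m * (1 + a) * (2 - a) \<le> (2 + a * B) * ((1 - s) * (1 + a * s - a * B * m))"
      by (simp only: mult.assoc mult.left_commute[of _ 2] mult_le_cancel_left_pos zero_less_numeral)
    then have "B * (m * (1 + a) * (2 - a)) \<le> B * ((2 + a * B) * ((1 - s) * (1 + a * s - a * B * m)))"
      using B by (intro mult_left_mono) auto
    then have "R * (1 + a) / ((1 - s) * (1 + a * s - a * R)) \<le> B * (2 + a * B) / (2 - a)"
      using a s p1 unfolding B by (simp add: divide_simps mult.assoc)
    then show ?thesis using near[OF True] by simp
  next
    case False
    define c where "c = (1 - a) * (1 - s)"
    have c: "0 < c" "c < a * B * m" using False a s B by (auto simp: c_def)
    \<comment> \<open>The largest \<open>m\<close> that \<open>s\<close> permits, to be inserted by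
      \<open>eliminate_second_radius\<close>.\<close>
    define \<mu> where "\<mu> = min s (1 - s)"
    have mu: "m \<le> \<mu>" "0 < \<mu>" using m s by (auto simp: \<mu>_def)
    have d2: "0 < 1 - a + a * \<mu>" using a mu by (auto intro: add_pos_nonneg)
    have elim: "m * (1 - a * t + a * R - c) / (1 - a * t) \<le> \<mu> * (1 - a + a * \<mu> + a * B * \<mu> - c) / (1 - a + a * \<mu>)"
      using eliminate_second_radius[of a m t \<mu> c "a * B"] a m mu c B by (simp add: mult.assoc)
    have fin: "\<mu> * (1 + a) * (1 - a + a * \<mu> + a * B * \<mu> - c) * (2 - a) \<le> (2 + a * B) * ((1 - s) * (a + s) * (1 - a + a * \<mu>))"
    proof (cases "1/2 \<le> s")
      case True
      then have mus: "\<mu> = 1 - s" by (simp add: \<mu>_def)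
      \<comment> \<open>After division by \<open>1 - s\<close> the gap in \<open>fin\<close> is a
        concave quadratic in \<open>s\<close>. The first two summands interpolate its values at
        \<open>s = 1/2\<close> and \<open>s = 1\<close>; the third is its excess over that
        chord.\<close>
      have "0 \<le> (2 - 2 * s) * ((2 - a) * a * (2 - B) / 4) + (2 * s - 1) * ((1 - a) * (1 + a) * a * (1 + B))
                + (2 + a * B) * a * (1 - s) * (s - 1/2)"
        using True a B s by (intro add_nonneg_nonneg mult_nonneg_nonneg divide_nonneg_nonneg) auto
      then have "(1 + a) * (a + s - 2 * a * s + a * B * (1 - s)) * (2 - a) \<le> (2 + a * B) * ((a + s) * (1 - a * s))"
        by (simp add: field_simps)
      then have "(1 - s) * ((1 + a) * (a + s - 2 * a * s + a * B * (1 - s)) * (2 - a)) \<le> (1 - s) * ((2 + a * B) * ((a + s) * (1 - a * s)))"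
        using s by (intro mult_left_mono) auto
      then show ?thesis unfolding mus c_def by (simp add: algebra_simps)
    next
      case False
      then have mus: "\<mu> = s" by (simp add: \<mu>_def)
      \<comment> \<open>For \<open>s < 1/2\<close> the claim splits into \<open>e1\<close> and
        \<open>e2\<close>, both equalities at \<open>s = 1/2\<close>, and an inequality in
        \<open>a\<close> and \<open>B\<close> that amounts to
        \<open>a * B \<le> 2 * a\<close>.\<close>
      have "0 \<le> (1 - 2 * s) * (2 * a + s)" using False a s by simp
      then have e1: "s * (2 * a + 1) \<le> 2 * ((1 - s) * (a + s))" by (simp add: algebra_simps)
      have "0 \<le> (1 - 2 * s) * (1 - a)" using False a s by simp
      then have e2: "s * (2 - a) \<le> 1 - a + a * s" by (simp add: algebra_simps)
      have "2 * ((1 + a) * (1 + a * B)) \<le> (2 + a * B) * (2 * a + 1)"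
        using aB by (simp add: algebra_simps)
      then have "(s * s * (2 - a)) * (2 * ((1 + a) * (1 + a * B))) \<le> (s * s * (2 - a)) * ((2 + a * B) * (2 * a + 1))"
        using a s by (intro mult_left_mono) auto
      also have "\<dots> = (2 + a * B) * ((s * (2 * a + 1)) * (s * (2 - a)))" by simp
      also have "\<dots> \<le> (2 + a * B) * ((2 * ((1 - s) * (a + s))) * (1 - a + a * s))"
        by (rule mult_left_mono[OF mult_mono[OF e1 e2]]) (use a s B in auto)
      finally show ?thesis unfolding mus c_def by (simp add: algebra_simps)
    qed
    have "A \<le> B * (1 + a) * (m * (1 - a * t + a * R - c) / (1 - a * t)) / ((1 - s) * (a + s))"
      using far False B by (simp add: c_def mult_ac)
    also have "\<dots> \<le> B * (1 + a) * (\<mu> * (1 - a + a * \<mu> + a * B * \<mu> - c) / (1 - a + a * \<mu>)) / ((1 - s) * (a + s))"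
      using elim a s B by (intro divide_right_mono mult_left_mono) auto
    also have "\<dots> \<le> B * (2 + a * B) / (2 - a)"
      using mult_left_mono[OF fin B(1)] a s d2 by (simp add: divide_simps mult_ac)
    finally show ?thesis .
  qed
qed

lemma circle_quotient_ge2:
  fixes a s t R B m A :: real
  assumes a: "0 \<le> a" "a < 1" and s: "0 < s" "s < 1" and t: "t < 1"
   and m: "0 < m" "m \<le> 1 - s" "m \<le> 1 - t"
   and B: "2 \<le> B" "R = B * m"
   and near: "a * R \<le> (1 - a) * (1 - s) \<Longrightarrow> A \<le> R * (1 + a) / ((1 - s) * (1 + a * s - a * R))"
   and far: "(1 - a) * (1 - s) < a * R \<Longrightarrow>
     A \<le> R * (1 + a) * (1 - a * t + a * R - (1 - a) * (1 - s)) / ((1 - s) * (a + s) * (1 - a * t))"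
   and basic: "A \<le> R * (1 + a) / ((1 - s) * (1 - a * t))"
  shows "A \<le> B * (2 + B) * (1 + a) / (2 + B - a * B)"
proof -
  have "a * t \<le> a * 1" using a t by (intro mult_left_mono) auto
  then have pos: "0 < 1 - a * t" using a by simp
  have aB: "a * B \<le> B" using mult_right_mono[of a 1 B] a B by simp
  \<comment> \<open>For \<open>B \<ge> 2\<close>, antipodal points of radius \<open>\<sigma>\<close>
    have \<open>R = 2 * \<sigma>\<close> and \<open>m = 1 - \<sigma>\<close>, hence quotient
    \<open>B\<close>; this is \<open>Bs\<close>. The target becomes
    \<open>B * (1 + a) / (1 - a * \<sigma>)\<close>, the value of the three estimates at such a
    pair.\<close>
  define \<sigma> where "\<sigma> = B / (2 + B)"
  have sg: "0 < \<sigma>" "\<sigma> < 1" using B by (auto simp: \<sigma>_def)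
  have Bs: "B * (1 - \<sigma>) = 2 * \<sigma>" using B by (simp add: \<sigma>_def field_simps)
  have asg: "0 < 1 - a * \<sigma>" using a sg mult_strict_mono[of a 1 \<sigma> 1] by auto
  have tgt: "B * (2 + B) * (1 + a) / (2 + B - a * B) = B * (1 + a) / (1 - a * \<sigma>)"
    using B aB by (simp add: \<sigma>_def divide_simps)
  consider "s \<le> \<sigma>" | "\<sigma> < s" "a * R \<le> (1 - a) * (1 - s)" | "\<sigma> < s" "(1 - a) * (1 - s) < a * R"
    by linarith
  then have "A \<le> B * (1 + a) / (1 - a * \<sigma>)"
  proof cases
    case 1
    have "m * (1 - a * \<sigma>) \<le> (1 - s) * (1 - a * t)"
    proof (cases "t \<le> \<sigma>")
      case True
      then show ?thesis using m asg s a by (intro mult_mono) (auto intro: mult_left_mono)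
    next
      case False
      have "m * (1 - a * \<sigma>) \<le> (1 - t) * (1 - a * \<sigma>)" using m asg by (intro mult_right_mono) auto
      \<comment> \<open>\<open>(1 - t) / (1 - a * t)\<close> decreases in \<open>t\<close>, so
        beyond \<open>\<sigma>\<close> it is bounded by its value there.\<close>
      also have "\<dots> = (1 - \<sigma>) * (1 - a * t) - (1 - a) * (t - \<sigma>)" by (simp add: algebra_simps)
      also have "\<dots> \<le> (1 - \<sigma>) * (1 - a * t)" using a False by simp
      also have "\<dots> \<le> (1 - s) * (1 - a * t)" using pos 1 by (intro mult_right_mono) auto
      finally show ?thesis .
    qed
    from mult_left_mono[OF this, of "B * (1 + a)"]
    have "R * (1 + a) / ((1 - s) * (1 - a * t)) \<le> B * (1 + a) / (1 - a * \<sigma>)"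
      using a B s pos asg by (simp add: divide_simps mult_ac)
    with basic show ?thesis by simp
  next
    case 2
    have "B * m \<le> B * (1 - s)" using m B by (intro mult_left_mono) auto
    also have "\<dots> \<le> B * (1 - \<sigma>)" using 2 B by (intro mult_left_mono) auto
    finally have "R - s \<le> \<sigma>" using Bs B 2 by simp
    then have "a * (R - s) \<le> a * \<sigma>" using a by (intro mult_left_mono) auto
    then have d: "1 - a * \<sigma> \<le> 1 + a * s - a * R" by (simp add: algebra_simps)
    then have "m * (1 - a * \<sigma>) \<le> (1 - s) * (1 + a * s - a * R)"
      using m asg s by (intro mult_mono) auto
    from mult_left_mono[OF this, of "B * (1 + a)"]
    have "R * (1 + a) / ((1 - s) * (1 + a * s - a * R)) \<le> B * (1 + a) / (1 - a * \<sigma>)"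
      using a B s d asg by (simp add: divide_simps mult_ac)
    with near[OF 2(2)] show ?thesis by simp
  next
    case 3
    define c where "c = (1 - a) * (1 - s)"
    have c: "0 < c" "c < a * B * m" using 3 a s B by (auto simp: c_def)
    have "a * s < 1" using a s mult_strict_mono[of a 1 s 1] by auto
    then have d2: "0 < 1 - a + a * (1 - s)" by (simp add: algebra_simps)
    have elim: "m * (1 - a * t + a * R - c) / (1 - a * t) \<le> (1 - s) * (a + s - 2 * a * s + a * B * (1 - s)) / (1 - a * s)"
      using eliminate_second_radius[of a m t "1 - s" c "a * B"] a m c B by (simp add: c_def algebra_simps)
    have fin: "(a + s - 2 * a * s + a * B * (1 - s)) * (1 - a * \<sigma>) \<le> (a + s) * (1 - a * s)"
    proof -
      \<comment> \<open>Multiplying by \<open>1 - \<sigma>\<close> lets \<open>Bs\<close> eliminate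
        \<open>B\<close>; the gap then has the factor \<open>s - \<sigma>\<close>.\<close>
      have "(1 - \<sigma>) * ((a + s - 2 * a * s + a * B * (1 - s)) * (1 - a * \<sigma>))
         = ((1 - \<sigma>) * (a + s - 2 * a * s) + a * (B * (1 - \<sigma>)) * (1 - s)) * (1 - a * \<sigma>)"
        by (simp add: algebra_simps)
      also have "\<dots> = (1 - \<sigma>) * ((a + s) * (1 - a * s)) - ((s - \<sigma>) * ((1 - a) * a * (1 + \<sigma>)) + a * (1 - s) * (s - \<sigma>) * (1 - \<sigma>))"
        unfolding Bs by (simp add: algebra_simps)
      also have "\<dots> \<le> (1 - \<sigma>) * ((a + s) * (1 - a * s))"
        unfolding diff_le_eq le_add_same_cancel1
        by (intro add_nonneg_nonneg mult_nonneg_nonneg) (use 3 a s sg in auto)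
      finally show ?thesis using sg by simp
    qed
    have "A \<le> B * (1 + a) * (m * (1 - a * t + a * R - c) / (1 - a * t)) / ((1 - s) * (a + s))"
      using far 3 B by (simp add: c_def mult_ac)
    also have "\<dots> \<le> B * (1 + a) * ((1 - s) * (a + s - 2 * a * s + a * B * (1 - s)) / (1 - a * s)) / ((1 - s) * (a + s))"
      using elim a s B by (intro divide_right_mono mult_left_mono) auto
    also have "\<dots> = B * (1 + a) * ((a + s - 2 * a * s + a * B * (1 - s)) / ((a + s) * (1 - a * s)))"
      using s by (simp add: mult_ac)
    also have "\<dots> \<le> B * (1 + a) * (1 / (1 - a * \<sigma>))"
      using fin a s B asg \<open>a * s < 1\<close> by (intro mult_left_mono) (auto simp: divide_simps)
    finally show ?thesis by simp
  qed
  then show ?thesis unfolding tgt .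
qed

section \<open>From the quotient bounds to logarithms\<close>

text \<open>The excess of \<open>C(a)\<close> over 1: raising 3 to it gives
  \<open>(2 + a) / (2 - a)\<close>, which is what matching at \<open>B = 2\<close> requires.\<close>

definition excess_exponent :: "real \<Rightarrow> real" where
  "excess_exponent a = ln ((2 + a) / (2 - a)) / ln 3"

text \<open>A concave function lies above its chord from the origin, so \<open>f v / v\<close>
  decreases. The product form also covers \<open>v = 0\<close> and \<open>w = 0\<close>.\<close>

lemma concave_ratio_decreasing:
  fixes f f' :: "real \<Rightarrow> real"
  assumes der: "\<And>x. 0 \<le> x \<Longrightarrow> x \<le> w \<Longrightarrow> (f has_real_derivative f' x) (at x)"
    and mono: "\<And>x y. 0 \<le> x \<Longrightarrow> x \<le> y \<Longrightarrow> y \<le> w \<Longrightarrow> f' y \<le> f' x"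
    and v: "0 \<le> v" "v \<le> w" and f0: "f 0 = 0"
  shows "v * f w \<le> w * f v"
proof (cases "w = 0")
  case True
  then show ?thesis using v f0 by simp
next
  case False
  then have w: "0 < w" using v by simp
  have "convex_on {0..w} (\<lambda>x. - f x)"
    by (rule convex_on_realI[where f' = "\<lambda>x. - f' x"]) (auto intro!: derivative_eq_intros der mono)
  then have "- f ((1 - v / w) *\<^sub>R 0 + (v / w) *\<^sub>R w) \<le> (1 - v / w) * (- f 0) + (v / w) * (- f w)"
    by (rule convex_onD) (use v w in auto)
  then have "v / w * f w \<le> f v" using w f0 by simp
  then show ?thesis using w by (simp add: field_simps)
qed

lemma excess_exponent_bounds:
  assumes "0 \<le> a" "a < 1" shows "0 \<le> excess_exponent a" "excess_exponent a \<le> 1" "3 powr excess_exponent a = (2 + a) / (2 - a)"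
proof -
  have b: "1 \<le> (2 + a) / (2 - a)" "(2 + a) / (2 - a) \<le> 3" using assms by (auto simp: divide_simps)
  then have "0 \<le> ln ((2 + a) / (2 - a))" "ln ((2 + a) / (2 - a)) \<le> ln 3" by (simp_all only: ln_ge_zero) (rule ln_mono, auto)
  then show "0 \<le> excess_exponent a" "excess_exponent a \<le> 1" unfolding excess_exponent_def by (simp_all add: divide_le_eq_1)
  show "3 powr excess_exponent a = (2 + a) / (2 - a)" using assms by (simp add: excess_exponent_def powr_def)
qed

text \<open>The factor \<open>1 + B\<close> splits off the argument of the logarithm and leaves
  \<open>1 + a * B / (2 - a)\<close>, which is the chord over \<open>[0, 2]\<close> of the concave
  function \<open>(1 + B) powr excess_exponent a\<close>.\<close>

lemma log_bound_le2:
  fixes a B :: real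
  assumes a: "0 \<le> a" "a < 1" and B: "0 \<le> B" "B \<le> 2"
  shows "ln (1 + B * (2 + a * B) / (2 - a)) \<le> (1 + excess_exponent a) * ln (1 + B)"
proof -
  define k where "k = excess_exponent a"
  note k = excess_exponent_bounds[OF a, folded k_def]
  have "B * ((1 + 2) powr k - 1) \<le> 2 * ((1 + B) powr k - 1)"
  proof (rule concave_ratio_decreasing[where f' = "\<lambda>x. k * (1 + x) powr (k - 1)"])
    show "((\<lambda>x. (1 + x) powr k - 1) has_real_derivative k * (1 + x) powr (k - 1)) (at x)" if "0 \<le> x" for x
      using that by (auto intro!: derivative_eq_intros)
    show "k * (1 + y) powr (k - 1) \<le> k * (1 + x) powr (k - 1)" if "0 \<le> x" "x \<le> y" for x y
      using that k by (intro mult_left_mono powr_mono2') auto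
  qed (use B in auto)
  then have "B * ((2 + a) / (2 - a) - 1) \<le> 2 * ((1 + B) powr k - 1)" using k(3) by simp
  then have "1 + a * B / (2 - a) \<le> (1 + B) powr k" using a by (simp add: field_simps)
  then have "(1 + B) * (1 + a * B / (2 - a)) \<le> (1 + B) * (1 + B) powr k" using B by (intro mult_left_mono) auto
  also have "\<dots> = (1 + B) powr (1 + k)" using B by (simp add: powr_add)
  also have "(1 + B) * (1 + a * B / (2 - a)) = 1 + B * (2 + a * B) / (2 - a)"
    using a by (simp add: field_simps)
  finally have le: "1 + B * (2 + a * B) / (2 - a) \<le> (1 + B) powr (1 + k)" .
  have "0 \<le> B * (2 + a * B) / (2 - a)" using a B by simp
  then have "ln (1 + B * (2 + a * B) / (2 - a)) \<le> ln ((1 + B) powr (1 + k))" using le by (intro ln_mono) auto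
  then show ?thesis using B by (simp add: ln_powr k_def)
qed

text \<open>Splitting off \<open>1 + B\<close> leaves
  \<open>(2 + B + a * B) / (2 + B - a * B)\<close>, whose logarithm is
  \<open>f (ln (1 + B))\<close>. Concavity of \<open>f\<close> compares it with the value at
  \<open>ln 3\<close>.\<close>

lemma log_bound_ge2:
  fixes a B :: real
  assumes a: "0 \<le> a" "a < 1" and B: "2 \<le> B"
  shows "ln (1 + B * (2 + B) * (1 + a) / (2 + B - a * B)) \<le> (1 + excess_exponent a) * ln (1 + B)"
proof -
  \<comment> \<open>\<open>f (2 * v) = 2 * artanh (a * tanh v)\<close>\<close>
  define f where "f = (\<lambda>x. ln ((1 + a) * exp x + (1 - a)) - ln ((1 - a) * exp x + (1 + a)))"
  \<comment> \<open>Written through \<open>exp x + exp (- x)\<close>, that is twice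
    \<open>cosh x\<close>, so that the decrease of the derivative for \<open>x \<ge> 0\<close> can
    be read off.\<close>
  define f' where "f' = (\<lambda>x. 4 * a / ((1 - a\<^sup>2) * (exp x + exp (- x)) + 2 * (1 + a\<^sup>2)))"
  have a2: "a\<^sup>2 < 1" using a by (simp add: power_less_one_iff)
  have pos: "0 < (1 + a) * exp x + (1 - a)" "0 < (1 - a) * exp x + (1 + a)" for x :: real
  proof -
    have "0 < (1 + a) * exp x" "0 < (1 - a) * exp x" using a by simp_all
    then show "0 < (1 + a) * exp x + (1 - a)" "0 < (1 - a) * exp x + (1 + a)" using a by (linarith, linarith)
  qed
  have aB: "0 < 2 + B - a * B" using mult_right_mono[of a 1 B] a B by linarith
  have fu: "f (ln u) = ln (((1 + a) * u + (1 - a)) / ((1 - a) * u + (1 + a)))" if "0 < u" for u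
    using that pos[of "ln u"] by (simp add: f_def ln_div)
  have "ln 3 * f (ln (1 + B)) \<le> ln (1 + B) * f (ln 3)"
  proof (rule concave_ratio_decreasing[where f' = f'])
    fix x :: real assume x: "0 \<le> x"
    have "(f has_real_derivative (1 + a) * exp x / ((1 + a) * exp x + (1 - a)) - (1 - a) * exp x / ((1 - a) * exp x + (1 + a))) (at x)"
      unfolding f_def using pos[of x] by (auto intro!: derivative_eq_intros simp: divide_simps)
    also have "(1 + a) * exp x / ((1 + a) * exp x + (1 - a)) - (1 - a) * exp x / ((1 - a) * exp x + (1 + a))
       = (4 * a * exp x) / (((1 - a\<^sup>2) * (exp x + exp (- x)) + 2 * (1 + a\<^sup>2)) * exp x)"
    proof -
      have "((1 - a\<^sup>2) * (exp x + exp (- x)) + 2 * (1 + a\<^sup>2)) * exp x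
         = (1 - a\<^sup>2) * (exp x * exp x + exp (- x) * exp x) + 2 * (1 + a\<^sup>2) * exp x"
        by (simp add: algebra_simps)
      also have "exp (- x) * exp x = 1" by (simp add: exp_minus)
      also have "(1 - a\<^sup>2) * (exp x * exp x + 1) + 2 * (1 + a\<^sup>2) * exp x
         = ((1 + a) * exp x + (1 - a)) * ((1 - a) * exp x + (1 + a))"
        by (simp add: power2_eq_square algebra_simps)
      finally show ?thesis using pos[of x]
        by (simp add: diff_frac_eq) (simp add: algebra_simps)
    qed
    also have "\<dots> = f' x" by (simp add: f'_def)
    finally show "(f has_real_derivative f' x) (at x)" .
  next
    fix x y :: real assume xy: "0 \<le> x" "x \<le> y"
    have "exp x + exp (- x) \<le> exp y + exp (- y)"
      using cosh_real_nonneg_le_iff[of x y] xy by (simp add: cosh_def)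
    then have "(1 - a\<^sup>2) * (exp x + exp (- x)) \<le> (1 - a\<^sup>2) * (exp y + exp (- y))"
      using a2 by (intro mult_left_mono) auto
    moreover have "0 < (1 - a\<^sup>2) * (exp z + exp (- z))" for z :: real
      using a2 by (intro mult_pos_pos add_pos_pos) auto
    ultimately show "f' y \<le> f' x" unfolding f'_def using a
      by (intro divide_left_mono mult_pos_pos[OF add_pos_nonneg add_pos_nonneg]) auto
  qed (use B in \<open>auto simp: f_def\<close>)
  also have "f (ln 3) = excess_exponent a * ln 3"
  proof -
    have "((1 + a) * 3 + (1 - a)) / ((1 - a) * 3 + (1 + a)) = (2 + a) / (2 - a)"
      using a by (simp add: divide_simps) (simp add: algebra_simps)
    then show ?thesis by (simp add: fu excess_exponent_def)
  qed
  finally have le: "f (ln (1 + B)) \<le> excess_exponent a * ln (1 + B)" by (simp add: mult.left_commute)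
  have q: "((1 + a) * (1 + B) + (1 - a)) / ((1 - a) * (1 + B) + (1 + a)) = (2 + B + a * B) / (2 + B - a * B)"
    by (simp add: algebra_simps)
  have "1 + B * (2 + B) * (1 + a) / (2 + B - a * B) = (1 + B) * ((2 + B + a * B) / (2 + B - a * B))"
    using aB by (simp add: divide_simps) (simp add: algebra_simps)
  moreover have "0 < (2 + B + a * B) / (2 + B - a * B)" using aB a B by (intro divide_pos_pos add_pos_nonneg) auto
  ultimately have "ln (1 + B * (2 + B) * (1 + a) / (2 + B - a * B)) = ln (1 + B) + f (ln (1 + B))"
    using B fu[of "1 + B"] ln_mult_pos[of "1 + B" "(2 + B + a * B) / (2 + B - a * B)"] unfolding q by simp
  with le show ?thesis by (simp add: algebra_simps)
qed

section \<open>Boundary distances in the punctured disc\<close>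

lemma frontier_punctured_ball:
  fixes a :: complex
  assumes "a \<in> ball 0 1"
  shows "frontier (ball 0 1 - {a}) = insert a (sphere 0 1)"
proof -
  have "closure (ball 0 1 - {a}) = closure (ball 0 1)"
    using closure_open_Int_superset[of "ball 0 1" "- {a}"] by (simp add: Diff_eq closure_complement)
  moreover have "interior (ball 0 1 - {a}) = ball 0 1 - {a}"
    by (intro interior_open open_delete) simp
  ultimately have "frontier (ball 0 1 - {a}) = cball 0 1 - (ball 0 1 - {a})"
    by (simp add: frontier_def)
  also have "\<dots> = insert a (sphere 0 1)" using assms by auto
  finally show ?thesis .
qed

lemma infdist_sphere:
  fixes z :: complex
  assumes "z \<in> ball 0 1" shows "infdist z (sphere 0 1) = 1 - norm z"
proof (rule antisym)
  \<comment> \<open>The nearest point of the circle is \<open>sgn z\<close>; at the origin, where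
    \<open>sgn\<close> vanishes, all points are equally near and 1 is taken.\<close>
  have w: "(if z = 0 then 1 else sgn z) \<in> sphere 0 1" by (auto simp: norm_sgn)
  have "dist z (if z = 0 then 1 else sgn z) = 1 - norm z"
  proof (cases "z = 0")
    case False
    have "z - sgn z = of_real (norm z - 1) * sgn z"
      using False by (simp add: sgn_div_norm algebra_simps scaleR_conv_of_real)
    then have "norm (z - sgn z) = \<bar>norm z - 1\<bar> * norm (sgn z)" by (simp only: norm_mult norm_of_real)
    then show ?thesis using False assms by (simp add: dist_norm norm_sgn)
  qed simp
  then show "infdist z (sphere 0 1) \<le> 1 - norm z" using infdist_le[OF w, of z] by simp
  have "sphere (0::complex) 1 \<noteq> {}" using w by auto
  then show "1 - norm z \<le> infdist z (sphere 0 1)" unfolding infdist_notempty[OF \<open>sphere 0 1 \<noteq> {}\<close>]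
  proof (rule cINF_greatest)
    fix w :: complex assume "w \<in> sphere 0 1"
    then show "1 - norm z \<le> dist z w" using norm_triangle_ineq2[of w z] by (simp add: dist_norm norm_minus_commute)
  qed
qed

lemma infdist_frontier_punctured_ball:
  fixes a z :: complex
  assumes "a \<in> ball 0 1" "z \<in> ball 0 1"
  shows "infdist z (frontier (ball 0 1 - {a})) = min (dist z a) (1 - norm z)"
proof -
  have "sphere (0::complex) 1 \<noteq> {}" by simp
  then have "infdist z ({a} \<union> sphere 0 1) = min (infdist z {a}) (infdist z (sphere 0 1))"
    by (intro infdist_Un_min) auto
  then show ?thesis using assms by (simp add: frontier_punctured_ball infdist_sphere)
qed

section \<open>Disc automorphisms and the normal form of \<open>h\<close>\<close>

lemma unit_denominator_nonzero:
  fixes a z :: complex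
  assumes "norm a < 1" "norm z < 1" shows "1 + cnj a * z \<noteq> 0"
proof
  assume "1 + cnj a * z = 0"
  then have "cnj a * z = - 1" by (simp add: add_eq_0_iff)
  then have "norm a * norm z = 1" by (metis complex_mod_cnj norm_minus_cancel norm_mult norm_one)
  moreover have "norm a * norm z < 1" using assms mult_strict_mono[of "norm a" 1 "norm z" 1] by simp
  ultimately show False by simp
qed

text \<open>Serves both the invariance of the disc and the relation between \<open>p\<close> and
  \<open>q\<close> in the circle estimates.\<close>

lemma norm_disc_automorphism:
  fixes a z :: complex
  shows "(norm (1 + cnj a * z))\<^sup>2 - (norm (z + a))\<^sup>2 = (1 - (norm a)\<^sup>2) * (1 - (norm z)\<^sup>2)"
  unfolding cmod_power2 by (simp add: power2_eq_square algebra_simps)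

lemma disc_automorphism_in_ball:
  fixes a z :: complex
  assumes "norm a < 1" "norm z < 1" shows "norm ((z + a) / (1 + cnj a * z)) < 1"
proof -
  have "0 < (1 - (norm a)\<^sup>2) * (1 - (norm z)\<^sup>2)" using assms by (simp add: power_less_one_iff)
  then have "(norm (z + a))\<^sup>2 < (norm (1 + cnj a * z))\<^sup>2" using norm_disc_automorphism[of a z] by simp
  then have "norm (z + a) < norm (1 + cnj a * z)" by (rule power2_less_imp_less) simp
  then show ?thesis by (simp add: norm_divide divide_less_eq)
qed

lemma mult_cnj_sgn: "C * cnj (sgn C) = of_real (norm C)"
  by (cases "C = 0") (simp_all add: sgn_eq complex_norm_square[symmetric] power2_eq_square)

text \<open>For fractional linear maps the Schwarz lemma is elementary: testing \<open>z\<close> on the ray where \<open>C * z < 0\<close>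
  gives \<open>norm A + norm C \<le> 1\<close>, and testing \<open>w\<close> with \<open>C * w\<close> parallel to \<open>A\<close> excludes \<open>C \<noteq> 0\<close>.\<close>

lemma moebius_fix_zero_rotation:
  fixes A C :: complex
  assumes into: "\<And>z. norm z < 1 \<Longrightarrow> C * z + 1 \<noteq> 0 \<and> norm (A * z / (C * z + 1)) < 1"
    and onto: "\<And>w. norm w < 1 \<Longrightarrow> \<exists>z. norm z < 1 \<and> A * z / (C * z + 1) = w"
  shows "C = 0" "norm A = 1"
proof -
  \<comment> \<open>The preimage of \<open>w\<close> is \<open>w / (A - C * w)\<close>, and it must
    lie in the disc.\<close>
  have surj: "norm w < norm (A - C * w)" if w: "norm w < 1" "w \<noteq> 0" for w
  proof -
    obtain z where z: "norm z < 1" "A * z / (C * z + 1) = w" using onto w by blast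
    then have "A * z = w * (C * z + 1)" using into[of z] by (auto simp: divide_eq_eq)
    then have e: "z * (A - C * w) = w" by (simp add: algebra_simps)
    then have "norm z * norm (A - C * w) = norm w" by (metis norm_mult)
    moreover have "A - C * w \<noteq> 0" using e w by auto
    ultimately show ?thesis using z mult_strict_right_mono[of "norm z" 1 "norm (A - C * w)"] by simp
  qed
  have A0: "A \<noteq> 0" using onto[of "1/2"] by auto
  have C1: "norm C \<le> 1"
  proof (rule ccontr)
    assume "\<not> norm C \<le> 1"
    then have "norm (- 1 / C) < 1" "C * (- 1 / C) + 1 = 0" by (auto simp: norm_divide divide_less_eq)
    then show False using into[of "- 1 / C"] by simp
  qed
  have r: "(norm A + norm C) * r < 1" if "0 \<le> r" "r < 1" for r :: real
  proof -
    \<comment> \<open>Chosen so that \<open>norm z = r\<close> and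
      \<open>C * z = - norm C * r\<close>.\<close>
    define z where "z = (if C = 0 then of_real r else - of_real r * cnj (sgn C))"
    have nz: "norm z = r" using that by (simp add: z_def norm_mult norm_sgn)
    have cz: "C * z + 1 = of_real (1 - norm C * r)"
    proof (cases "C = 0")
      case False
      then have "C * z + 1 = 1 - of_real r * (C * cnj (sgn C))" by (simp add: z_def)
      then show ?thesis by (simp add: mult_cnj_sgn mult.commute)
    qed (simp add: z_def)
    have "norm C * r < 1" using C1 that mult_right_mono[of "norm C" 1 r] by simp
    moreover from this have "norm (C * z + 1) = 1 - norm C * r" unfolding cz norm_of_real by simp
    ultimately have "norm A * r < 1 - norm C * r" using into[of z] that nz
      by (simp add: norm_divide norm_mult divide_less_eq)
    then show ?thesis by (simp add: algebra_simps)
  qed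
  have AC: "norm A + norm C \<le> 1"
  proof (rule ccontr)
    assume "\<not> norm A + norm C \<le> 1"
    then show False using r[of "1 / (norm A + norm C)"] by simp
  qed
  show C0: "C = 0"
  proof (rule ccontr)
    assume C: "C \<noteq> 0"
    \<comment> \<open>With this radius \<open>norm A \<le> \<rho>\<close> and
      \<open>norm C * \<rho> \<le> \<rho>\<close>; for parallel vectors this forces
      \<open>norm (A - C * w) \<le> \<rho> = norm w\<close>, against \<open>surj\<close>.\<close>
    define \<rho> where "\<rho> = 1 - norm C"
    have rho: "0 < \<rho>" "\<rho> < 1" using C AC A0 by (auto simp: \<rho>_def) (smt (verit) zero_less_norm_iff)
    define w where "w = of_real \<rho> * (sgn A * cnj (sgn C))"
    have nw: "norm w = \<rho>" using rho A0 C by (simp add: w_def norm_mult norm_sgn)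
    have "C * w = sgn A * (of_real \<rho> * (C * cnj (sgn C)))" by (simp add: w_def mult_ac)
    also have "\<dots> = sgn A * of_real (norm C * \<rho>)" unfolding mult_cnj_sgn by simp
    moreover have "A = sgn A * of_real (norm A)" using A0 by (simp add: sgn_eq)
    ultimately have "A - C * w = sgn A * of_real (norm A - norm C * \<rho>)"
      by (metis of_real_diff right_diff_distrib)
    then have "norm (A - C * w) = \<bar>norm A - norm C * \<rho>\<bar>" using A0 by (simp only: norm_mult norm_of_real) (simp add: norm_sgn)
    moreover have "norm C * \<rho> \<le> 1 * \<rho>" using rho C1 by (intro mult_right_mono) auto
    moreover have "0 \<le> norm C * \<rho>" using rho by simp
    moreover have "\<rho> < norm (A - C * w)" using surj[of w] nw rho by auto
    ultimately show False using AC norm_ge_zero[of A] \<rho>_def by linarith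
  qed
  show "norm A = 1"
  proof (rule ccontr)
    assume "norm A \<noteq> 1"
    then have "norm A < 1" using AC by (smt (verit) norm_ge_zero)
    then show False using surj[of A] A0 C0 by simp
  qed
qed

text \<open>Following \<open>h\<close> by the automorphism that moves \<open>a\<close> to 0 gives a
  fractional linear map of the disc onto itself fixing 0, hence a rotation; undoing that
  automorphism gives the normal form.\<close>

lemma fractional_linear_disc_automorphism:
  fixes a \<alpha> \<beta> \<gamma> \<delta> :: complex
  assumes a: "norm a < 1"
    and h: "\<And>z. norm z < 1 \<Longrightarrow> \<gamma> * z + \<delta> \<noteq> 0 \<and> h z = (\<alpha> * z + \<beta>) / (\<gamma> * z + \<delta>)"
    and h0: "h 0 = a" and onto: "h ` ball 0 1 = ball 0 1"
  obtains k where "norm k = 1" "\<And>z. norm z < 1 \<Longrightarrow> h z = (k * z + a) / (1 + cnj a * (k * z))"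
proof -
  have d0: "\<delta> \<noteq> 0" and b: "\<beta> = a * \<delta>" using h[of 0] h0 by (auto simp: divide_eq_eq)
  define n where "n = 1 - a * cnj a"
  have "norm (a * cnj a) < 1" using a mult_strict_mono[of "norm a" 1 "norm a" 1] by (simp add: norm_mult)
  then have n0: "n \<noteq> 0" unfolding n_def by auto
  \<comment> \<open>Coefficients of the composite map \<open>A * z / (C * z + 1)\<close>; division
    by \<open>\<delta> * n\<close> normalises the constant term of the denominator to 1.\<close>
  define A C where "A = (\<alpha> - a * \<gamma>) / (\<delta> * n)" and "C = (\<gamma> - cnj a * \<alpha>) / (\<delta> * n)"
  have hb: "norm (h z) < 1" if "norm z < 1" for z using onto that by (metis imageI mem_ball_0)
  have den: "1 - cnj a * w \<noteq> 0" if "norm w < 1" for w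
    using unit_denominator_nonzero[of "- a" w] a that by simp
  have hm: "h z * (\<gamma> * z + \<delta>) = \<alpha> * z + a * \<delta>" if "norm z < 1" for z
    using h[OF that] b by simp
  have Cz: "C * z + 1 = (1 - cnj a * h z) * (\<gamma> * z + \<delta>) / (\<delta> * n)" if "norm z < 1" for z
  proof -
    have "(1 - cnj a * h z) * (\<gamma> * z + \<delta>) = (\<gamma> * z + \<delta>) - cnj a * (h z * (\<gamma> * z + \<delta>))"
      by (simp add: algebra_simps)
    also have "\<dots> = (\<gamma> - cnj a * \<alpha>) * z + \<delta> * n" unfolding hm[OF that] by (simp add: n_def algebra_simps)
    finally show ?thesis using d0 n0 by (simp add: C_def add_divide_distrib)
  qed
  have Az: "A * z = (h z - a) * (\<gamma> * z + \<delta>) / (\<delta> * n)" if "norm z < 1" for z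
  proof -
    have "(h z - a) * (\<gamma> * z + \<delta>) = h z * (\<gamma> * z + \<delta>) - a * (\<gamma> * z + \<delta>)"
      by (simp add: algebra_simps)
    also have "\<dots> = (\<alpha> - a * \<gamma>) * z" unfolding hm[OF that] by (simp add: algebra_simps)
    finally show ?thesis by (simp add: A_def)
  qed
  have nz: "C * z + 1 \<noteq> 0" if "norm z < 1" for z
    using Cz[OF that] h[OF that] den[OF hb[OF that]] d0 n0 by simp
  have quot: "A * z / (C * z + 1) = (h z - a) / (1 - cnj a * h z)" if "norm z < 1" for z
    using Az[OF that] Cz[OF that] h[OF that] den[OF hb[OF that]] d0 n0 by simp
  have into: "C * z + 1 \<noteq> 0 \<and> norm (A * z / (C * z + 1)) < 1" if "norm z < 1" for z
    using nz[OF that] quot[OF that] disc_automorphism_in_ball[of "- a" "h z"] a hb[OF that] by simp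
  have surj: "\<exists>z. norm z < 1 \<and> A * z / (C * z + 1) = w" if w: "norm w < 1" for w
    proof -
      define v where "v = (w + a) / (1 + cnj a * w)"
      have v: "norm v < 1" unfolding v_def using a w by (rule disc_automorphism_in_ball)
      then obtain z where z: "norm z < 1" "h z = v" using onto by (metis imageE mem_ball_0)
      have "1 + cnj a * w \<noteq> 0" using a w by (rule unit_denominator_nonzero)
      then have "v * (1 + cnj a * w) = w + a" by (simp add: v_def)
      then have "v - a = w * (1 - cnj a * v)" by (simp add: algebra_simps)
      then have "(v - a) / (1 - cnj a * v) = w" using den[OF v] by simp
      then show ?thesis using z quot by auto
    qed
  note AC = moebius_fix_zero_rotation[OF into surj]
  show thesis
  proof
    show "norm A = 1" by (rule AC)
    show "h z = (A * z + a) / (1 + cnj a * (A * z))" if z: "norm z < 1" for z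
    proof -
      have "A * z = (h z - a) / (1 - cnj a * h z)" using quot[OF z] AC by simp
      then have "A * z * (1 - cnj a * h z) = h z - a" using den[OF hb[OF z]] by simp
      then have "h z * (1 + cnj a * (A * z)) = A * z + a" by (simp add: algebra_simps)
      moreover have "1 + cnj a * (A * z) \<noteq> 0"
        using unit_denominator_nonzero[of a "A * z"] a z AC by (simp add: norm_mult)
      ultimately show ?thesis by (simp add: eq_divide_eq)
    qed
  qed
qed

text \<open>\<open>\<rho>\<close> is \<open>k * z\<close> or \<open>k * cnj z\<close> with
  \<open>norm k = 1\<close>. Its isometry properties leave the source metric unchanged, and
  surjectivity allows points to be prescribed through their values under
  \<open>\<rho>\<close>.\<close>

lemma moebius_disc_normal_form:
  fixes a :: complex
  assumes a: "norm a < 1" and m: "moebius_on (ball 0 1) h"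
    and onto: "h ` (ball 0 1 - {0}) = ball 0 1 - {a}" and h0: "h 0 = a"
  obtains \<rho> where "\<And>z. norm (\<rho> z) = norm z" "\<And>z w. dist (\<rho> z) (\<rho> w) = dist z w" "surj \<rho>"
    "\<And>z. norm z < 1 \<Longrightarrow> h z = (\<rho> z + a) / (1 + cnj a * \<rho> z)"
proof -
  have "ball (0::complex) 1 = insert 0 (ball 0 1 - {0})" by auto
  then have "h ` ball 0 1 = insert (h 0) (h ` (ball 0 1 - {0}))" by (metis image_insert)
  then have onto': "h ` ball 0 1 = ball 0 1" using onto h0 a by auto
  have rot: "norm (k * z) = norm z" "dist (k * z) (k * w) = dist z w" if "norm k = 1" for k z w :: complex
    using that by (auto simp: norm_mult dist_norm simp flip: right_diff_distrib)
  have iso: "dist (cnj z) (cnj w) = dist z w" for z w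
    by (metis complex_cnj_diff complex_mod_cnj dist_norm)
  obtain \<alpha> \<beta> \<gamma> \<delta> where
    "(\<forall>z\<in>ball 0 1. \<gamma> * z + \<delta> \<noteq> 0 \<and> h z = (\<alpha> * z + \<beta>) / (\<gamma> * z + \<delta>)) \<or>
     (\<forall>z\<in>ball 0 1. \<gamma> * cnj z + \<delta> \<noteq> 0 \<and> h z = (\<alpha> * cnj z + \<beta>) / (\<gamma> * cnj z + \<delta>))"
    using m unfolding moebius_on_def by blast
  then show thesis
  proof
    assume H: "\<forall>z\<in>ball 0 1. \<gamma> * z + \<delta> \<noteq> 0 \<and> h z = (\<alpha> * z + \<beta>) / (\<gamma> * z + \<delta>)"
    obtain k where k: "norm k = 1" "\<And>z. norm z < 1 \<Longrightarrow> h z = (k * z + a) / (1 + cnj a * (k * z))"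
      using fractional_linear_disc_automorphism[of a \<gamma> \<delta> h \<alpha> \<beta>] a H h0 onto' by auto
    have "k \<noteq> 0" using k by auto
    then have "surj (\<lambda>z. k * z)" by (intro surjI[of _ "\<lambda>z. z / k"]) auto
    then show thesis using that[of "\<lambda>z. k * z"] rot k by blast
  next
    assume H: "\<forall>z\<in>ball 0 1. \<gamma> * cnj z + \<delta> \<noteq> 0 \<and> h z = (\<alpha> * cnj z + \<beta>) / (\<gamma> * cnj z + \<delta>)"
    \<comment> \<open>The orientation-reversing case is reduced to the other one by passing to
      \<open>h \<circ> cnj\<close>.\<close>
    have "cnj ` ball 0 1 = ball 0 1"
    by (auto intro: image_eqI[of _ cnj "cnj _"])
    then have hc: "(h \<circ> cnj) ` ball 0 1 = ball 0 1" using onto' by (simp only: image_comp[symmetric])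
    have H': "\<gamma> * z + \<delta> \<noteq> 0 \<and> (h \<circ> cnj) z = (\<alpha> * z + \<beta>) / (\<gamma> * z + \<delta>)" if "norm z < 1" for z
      using H[rule_format, of "cnj z"] that by simp
    obtain k where k: "norm k = 1" "\<And>z. norm z < 1 \<Longrightarrow> (h \<circ> cnj) z = (k * z + a) / (1 + cnj a * (k * z))"
      by (rule fractional_linear_disc_automorphism[OF a H' _ hc]) (use h0 in auto)
    have "k \<noteq> 0" using k by auto
    then have sj: "surj (\<lambda>z. k * cnj z)" by (intro surjI[of _ "\<lambda>z. cnj (z / k)"]) auto
    have h': "h z = (k * cnj z + a) / (1 + cnj a * (k * cnj z))" if "norm z < 1" for z
      using k(2)[of "cnj z"] that by simp
    show thesis
      by (rule that[OF _ _ sj h']) (simp_all only: rot[OF k(1)] iso complex_mod_cnj)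
  qed
qed

section \<open>Image distances and the upper bound for disc automorphisms\<close>

lemma dist_disc_automorphism:
  fixes a x y :: complex
  assumes "norm a < 1" "norm x < 1" "norm y < 1"
  shows "dist ((x + a) / (1 + cnj a * x)) ((y + a) / (1 + cnj a * y))
    = (1 - (norm a)\<^sup>2) * dist x y / (norm (1 + cnj a * x) * norm (1 + cnj a * y))"
proof -
  have nz: "1 + cnj a * x \<noteq> 0" "1 + cnj a * y \<noteq> 0" using assms unit_denominator_nonzero by blast+
  have "(x + a) / (1 + cnj a * x) - (y + a) / (1 + cnj a * y)
      = ((x + a) * (1 + cnj a * y) - (y + a) * (1 + cnj a * x)) / ((1 + cnj a * x) * (1 + cnj a * y))"
    by (rule diff_frac_eq[OF nz])
  also have "(x + a) * (1 + cnj a * y) - (y + a) * (1 + cnj a * x) = (1 - a * cnj a) * (x - y)"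
    by (simp add: algebra_simps)
  also have "1 - a * cnj a = of_real (1 - (norm a)\<^sup>2)"
    by (simp only: of_real_diff of_real_1 complex_norm_square)
  finally have "dist ((x + a) / (1 + cnj a * x)) ((y + a) / (1 + cnj a * y))
    = \<bar>1 - (norm a)\<^sup>2\<bar> * norm (x - y) / (norm (1 + cnj a * x) * norm (1 + cnj a * y))"
    by (simp only: dist_norm norm_divide norm_mult norm_of_real)
  moreover have "(norm a)\<^sup>2 < 1" using assms by (simp add: power_less_one_iff)
  ultimately show ?thesis by (simp add: dist_norm)
qed

text \<open>Only the boundary distance of \<open>X\<close> enters on the left; the theorem uses both
  orders of the pair to cover the minimum.\<close>

lemma disc_automorphism_ratio_bound:
  fixes a x y :: complex
  assumes a: "norm a < 1" and x: "0 < norm x" "norm x < 1" and y: "0 < norm y" "norm y < 1"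
  defines "X \<equiv> (x + a) / (1 + cnj a * x)" and "Y \<equiv> (y + a) / (1 + cnj a * y)"
  defines "m \<equiv> min (min (norm x) (1 - norm x)) (min (norm y) (1 - norm y))"
  shows "ln (1 + dist X Y / min (dist X a) (1 - norm X)) \<le> (1 + excess_exponent (norm a)) * ln (1 + dist x y / m)"
proof -
  define \<alpha> s t R B where "\<alpha> = norm a" and "s = norm x" and "t = norm y" and "R = dist x y" and "B = R / m"
  define q p Q where "q = norm (1 + cnj a * x)" and "p = norm (x + a)" and "Q = norm (1 + cnj a * y)"
  define A where "A = dist X Y / min (dist X a) (1 - norm X)"
  have al: "0 \<le> \<alpha>" "\<alpha> < 1" using a by (auto simp: \<alpha>_def)
  have s: "0 < s" "s < 1" and t: "0 < t" "t < 1" using x y by (auto simp: s_def t_def)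
  have m: "0 < m" "m \<le> s" "m \<le> 1 - s" "m \<le> 1 - t" using x y by (auto simp: m_def s_def t_def)
  have R: "0 \<le> R" and B: "0 \<le> B" "R = B * m" using m by (auto simp: R_def B_def)
  have tri: "t \<le> s + R" unfolding t_def s_def R_def
    by (metis dist_norm norm_minus_commute norm_triangle_sub)
  have q0: "0 < q" using unit_denominator_nonzero[OF a x(2)] by (simp add: q_def)
  have p0: "0 \<le> p" by (simp add: p_def)
  have q1: "q \<le> 1 + \<alpha> * s" unfolding q_def \<alpha>_def s_def
    by (metis complex_mod_cnj norm_mult norm_one norm_triangle_ineq)
  have qp: "q\<^sup>2 - p\<^sup>2 = (1 - \<alpha>\<^sup>2) * (1 - s\<^sup>2)" unfolding q_def p_def \<alpha>_def s_def by (rule norm_disc_automorphism)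
  have Q1: "1 - \<alpha> * t \<le> Q" unfolding Q_def \<alpha>_def t_def
    by (metis complex_mod_cnj norm_mult norm_one norm_diff_ineq)
  have "norm ((1 + cnj a * y) + cnj a * (x - y)) \<le> Q + norm (cnj a * (x - y))"
    unfolding Q_def by (rule norm_triangle_ineq)
  also have "(1 + cnj a * y) + cnj a * (x - y) = 1 + cnj a * x" by (simp add: algebra_simps)
  finally have Q2: "q - \<alpha> * R \<le> Q" by (simp add: q_def \<alpha>_def R_def dist_norm norm_mult)
  have Q0: "0 < Q" using unit_denominator_nonzero[OF a y(2)] by (simp add: Q_def)
  have al2: "0 < 1 - \<alpha>\<^sup>2" and s2: "0 < 1 - s\<^sup>2" using al s by (simp_all add: power_less_one_iff)
  have dXY: "dist X Y = (1 - \<alpha>\<^sup>2) * R / (q * Q)"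
    unfolding X_def Y_def using dist_disc_automorphism[OF a x(2) y(2)] by (simp add: \<alpha>_def R_def q_def Q_def)
  \<comment> \<open>The distance formula with second point 0, whose image is
    \<open>a\<close>.\<close>
  have dXa: "dist X a = (1 - \<alpha>\<^sup>2) * s / q"
    using dist_disc_automorphism[OF a x(2), of 0] by (simp add: X_def \<alpha>_def s_def q_def)
  have nX: "1 - norm X = (q - p) / q" using q0 by (simp add: X_def norm_divide p_def flip: q_def) (simp add: field_simps)
  have A_le: "(B \<le> 2 \<longrightarrow> A \<le> B * (2 + \<alpha> * B) / (2 - \<alpha>)) \<and>
      (2 \<le> B \<longrightarrow> A \<le> B * (2 + B) * (1 + \<alpha>) / (2 + B - \<alpha> * B))"
  proof (cases "dist X a \<le> 1 - norm X")
    case True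
    then have "A = R / (s * Q)" using q0 al2 by (simp add: A_def dXY) (simp add: dXa)
    then have "A \<le> B * (2 + B) / (2 + B - \<alpha> * (1 + B))"
      using puncture_quotient_bound[OF al s(1) t(2) m(2) m(4) m(1) B tri Q1] by simp
    then show ?thesis using quotient_bound_le2[OF al B(1)] quotient_bound_ge2[OF al B(1)] by (auto intro: order_trans)
  next
    case False
    \<comment> \<open>Multiplying by \<open>q + p\<close> turns the \<open>q - p\<close> coming from
      \<open>1 - norm X\<close> into the known product and yields the quotient of the circle
      estimates.\<close>
    have qp': "(q - p) * (q + p) = (1 - \<alpha>\<^sup>2) * (1 - s\<^sup>2)" using qp by (simp add: power2_eq_square algebra_simps)
    have "0 < (q - p) * (q + p)" unfolding qp' using al2 s2 by simp
    then have qmp: "0 < q - p" using q0 p0 by (simp add: zero_less_mult_iff)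
    have "A = (1 - \<alpha>\<^sup>2) * R / ((q - p) * Q)" using False q0 by (simp add: A_def dXY nX)
    also have "\<dots> = (1 - \<alpha>\<^sup>2) * R * (q + p) / ((q - p) * (q + p) * Q)" using q0 p0 by simp
    also have "\<dots> = R * (q + p) / ((1 - s\<^sup>2) * Q)" unfolding qp' using al2 by simp
    finally have A: "A = R * (q + p) / ((1 - s\<^sup>2) * Q)" .
    note split = circle_quotient_bounds[OF al s t(2) R p0 q0 q1 qp Q1 Q2, folded A]
    show ?thesis
      using circle_quotient_le2[OF al s t(2) m B(1) _ B(2) split(1,2)]
        circle_quotient_ge2[OF al s t(2) m(1) m(3) m(4) _ B(2) split(1,2,3)] by blast
  qed
  have "norm X < 1" unfolding X_def using a x(2) by (rule disc_automorphism_in_ball)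
  then have A0: "0 \<le> A" by (simp add: A_def)
  have "ln (1 + A) \<le> (1 + excess_exponent \<alpha>) * ln (1 + B)"
  proof (cases "B \<le> 2")
    case True
    have "ln (1 + A) \<le> ln (1 + B * (2 + \<alpha> * B) / (2 - \<alpha>))" using A_le True A0 by (intro ln_mono) auto
    also have "\<dots> \<le> (1 + excess_exponent \<alpha>) * ln (1 + B)" using al B(1) True by (rule log_bound_le2)
    finally show ?thesis .
  next
    case False
    then have B2: "2 \<le> B" by simp
    have "ln (1 + A) \<le> ln (1 + B * (2 + B) * (1 + \<alpha>) / (2 + B - \<alpha> * B))" using A_le B2 A0 by (intro ln_mono) auto
    also have "\<dots> \<le> (1 + excess_exponent \<alpha>) * ln (1 + B)" using al B2 by (rule log_bound_ge2)
    finally show ?thesis .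
  qed
  then show ?thesis by (simp add: A_def \<alpha>_def B_def R_def)
qed

section \<open>The extremal pair and the sharp constant\<close>

text \<open>The points \<open>0\<close>, \<open>a\<close> and both \<open>u / 2\<close> and
  \<open>- (u / 2)\<close> are collinear, so the denominators are real. The value is the common
  value of the two quotient bounds at \<open>B = 2\<close>.\<close>

lemma disc_automorphism_ratio_antipodal:
  fixes a u :: complex
  assumes a: "norm a < 1" and u: "norm u = 1" "a = of_real (norm a) * u"
  defines "X \<equiv> (u / 2 + a) / (1 + cnj a * (u / 2))" and "Y \<equiv> (- (u / 2) + a) / (1 + cnj a * (- (u / 2)))"
  shows "dist X Y / (1 - norm X) = 4 * (1 + norm a) / (2 - norm a)"
proof -
  define \<alpha> where "\<alpha> = norm a"
  have al: "0 \<le> \<alpha>" "\<alpha> < 1" using a by (auto simp: \<alpha>_def)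
  have cu: "cnj u * u = 1" using u complex_norm_square[of u] by (simp add: mult.commute)
  have "cnj a = of_real \<alpha> * cnj u" by (metis u(2) complex_cnj_mult complex_cnj_complex_of_real \<alpha>_def)
  then have ca: "cnj a * u = of_real \<alpha>" using cu by (simp add: mult.assoc)
  have d1: "1 + cnj a * (u / 2) = of_real (1 + \<alpha> / 2)" and d2: "1 + cnj a * (- (u / 2)) = of_real (1 - \<alpha> / 2)"
    using ca by simp_all
  have "u / 2 + a = of_real (1/2 + \<alpha>) * u" by (subst u(2)) (simp add: \<alpha>_def algebra_simps)
  then have "norm (u / 2 + a) = 1/2 + \<alpha>" using al by (simp only: norm_mult norm_of_real u(1)) simp
  then have "norm X = (1/2 + \<alpha>) / (1 + \<alpha> / 2)"
    unfolding X_def d1 norm_divide norm_of_real using al by simp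
  then have nX: "1 - norm X = (1 - \<alpha>) / (2 + \<alpha>)" using al by (simp add: field_simps)
  have "dist (u / 2) (- (u / 2)) = 1" using u by (simp add: dist_norm)
  then have "dist X Y = (1 - \<alpha>\<^sup>2) / ((1 + \<alpha> / 2) * (1 - \<alpha> / 2))"
    unfolding X_def Y_def d1 d2 using dist_disc_automorphism[of a "u / 2" "- (u / 2)", unfolded d1 d2 norm_of_real] a u al
    by (simp add: norm_divide \<alpha>_def)
  then have "dist X Y / (1 - norm X) = 4 * (1 + \<alpha>) / (2 - \<alpha>)"
    unfolding nX using al by (simp add: divide_simps power2_eq_square) (simp add: algebra_simps)
  then show ?thesis by (simp add: \<alpha>_def)
qed

theorem theorem1p6:
  fixes a :: complex and h :: "complex \<Rightarrow> complex"
  assumes "a \<in> ball 0 1"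
    and "moebius_on (ball 0 1) h"
    and "h ` (ball 0 1 - {0}) = ball 0 1 - {a}"
    and "h 0 = a"
  shows "(\<forall>x \<in> ball 0 1 - {0}. \<forall>y \<in> ball 0 1 - {0}.
            distance_ratio (ball 0 1 - {a}) (h x) (h y)
              \<le> lipschitz_bound a * distance_ratio (ball 0 1 - {0}) x y) \<and>
         (\<forall>C::real. (\<forall>x \<in> ball 0 1 - {0}. \<forall>y \<in> ball 0 1 - {0}.
            distance_ratio (ball 0 1 - {a}) (h x) (h y)
              \<le> C * distance_ratio (ball 0 1 - {0}) x y)
            \<longrightarrow> lipschitz_bound a \<le> C)"
proof -
  have a: "norm a < 1" using assms(1) by simp
  obtain \<rho> where \<rho>: "\<And>z. norm (\<rho> z) = norm z" "\<And>z w. dist (\<rho> z) (\<rho> w) = dist z w" "surj \<rho>"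
    and h: "\<And>z. norm z < 1 \<Longrightarrow> h z = (\<rho> z + a) / (1 + cnj a * \<rho> z)"
    using moebius_disc_normal_form[OF a assms(2-4)] by blast
  have lip: "lipschitz_bound a = 1 + excess_exponent (norm a)" by (simp add: lipschitz_bound_def excess_exponent_def)
  have src: "distance_ratio (ball 0 1 - {0}) x y
      = ln (1 + dist x y / min (min (norm x) (1 - norm x)) (min (norm y) (1 - norm y)))"
    if "norm x < 1" "norm y < 1" for x y :: complex
    using that by (simp add: distance_ratio_def infdist_frontier_punctured_ball)
  have img: "distance_ratio (ball 0 1 - {a}) (h x) (h y)
      = ln (1 + dist (h x) (h y) / min (min (dist (h x) a) (1 - norm (h x))) (min (dist (h y) a) (1 - norm (h y))))"
    if "norm x < 1" "norm y < 1" for x y :: complex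
  proof -
    have "h z \<in> ball 0 1" if "norm z < 1" for z
      using disc_automorphism_in_ball[OF a, of "\<rho> z"] \<rho>(1) h that by simp
    then show ?thesis using that assms(1) by (simp add: distance_ratio_def infdist_frontier_punctured_ball)
  qed
  have bound: "ln (1 + dist (h x) (h y) / min (dist (h x) a) (1 - norm (h x)))
      \<le> lipschitz_bound a * distance_ratio (ball 0 1 - {0}) x y"
    if "x \<in> ball 0 1 - {0}" "y \<in> ball 0 1 - {0}" for x y
    using disc_automorphism_ratio_bound[of a "\<rho> x" "\<rho> y"] a that by (simp add: \<rho> h src lip)
  have "distance_ratio (ball 0 1 - {a}) (h x) (h y) \<le> lipschitz_bound a * distance_ratio (ball 0 1 - {0}) x y"
    if xy: "x \<in> ball 0 1 - {0}" "y \<in> ball 0 1 - {0}" for x y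
  \<comment> \<open>If the smaller image distance belongs to \<open>h y\<close>, the bound is
    applied to the swapped pair.\<close>
  proof (cases "min (dist (h x) a) (1 - norm (h x)) \<le> min (dist (h y) a) (1 - norm (h y))")
    case True
    then show ?thesis using bound[OF xy] xy by (simp add: img min.absorb1)
  next
    case False
    have "distance_ratio (ball 0 1 - {0}) y x = distance_ratio (ball 0 1 - {0}) x y"
      by (simp add: distance_ratio_def dist_commute min.commute)
    moreover have "min (dist (h y) a) (1 - norm (h y)) \<le> min (dist (h x) a) (1 - norm (h x))" using False by linarith
    ultimately show ?thesis using bound[OF xy(2,1)] xy by (simp add: img min.absorb2 dist_commute[of "h y" "h x"])
  qed
  moreover have "lipschitz_bound a \<le> C"
    if C: "\<forall>x \<in> ball 0 1 - {0}. \<forall>y \<in> ball 0 1 - {0}.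
      distance_ratio (ball 0 1 - {a}) (h x) (h y) \<le> C * distance_ratio (ball 0 1 - {0}) x y" for C
  proof -
    \<comment> \<open>The direction of \<open>a\<close>, with 1 as default for \<open>a = 0\<close>,
      where any direction serves.\<close>
    define u where "u = (if a = 0 then 1 else sgn a)"
    have u: "norm u = 1" "a = of_real (norm a) * u" by (auto simp: u_def norm_sgn) (simp add: sgn_eq)
    obtain x y where xy: "\<rho> x = u / 2" "\<rho> y = - (u / 2)" using \<rho>(3) by (metis surjD)
    have nxy: "norm x = 1/2" "norm y = 1/2" using \<rho>(1)[of x] \<rho>(1)[of y] u unfolding xy by (simp_all add: norm_divide)
    have dxy: "dist x y = 1" using \<rho>(2)[of x y] u unfolding xy by (simp add: dist_norm)
    have ball: "x \<in> ball 0 1 - {0}" "y \<in> ball 0 1 - {0}" using nxy by auto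
    have s3: "distance_ratio (ball 0 1 - {0}) x y = ln 3" by (simp add: src nxy dxy)
    have pos: "0 < min (min (dist (h x) a) (1 - norm (h x))) (min (dist (h y) a) (1 - norm (h y)))"
    proof -
      have "h z \<in> ball 0 1 - {a}" if "z \<in> ball 0 1 - {0}" for z using assms(3) that by blast
      from this[OF ball(1)] this[OF ball(2)] show ?thesis by simp
    qed
    have "4 * (1 + norm a) / (2 - norm a) = dist (h x) (h y) / (1 - norm (h x))"
      using disc_automorphism_ratio_antipodal[OF a u] nxy by (simp add: h xy)
    \<comment> \<open>For a lower bound on the image metric it is enough that the minimum is at most
      \<open>1 - norm (h x)\<close>; positivity of the minimum permits the division.\<close>
    also have "\<dots> \<le> dist (h x) (h y) / min (min (dist (h x) a) (1 - norm (h x))) (min (dist (h y) a) (1 - norm (h y)))"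
      using pos by (intro divide_left_mono mult_pos_pos) auto
    finally have "ln (1 + 4 * (1 + norm a) / (2 - norm a)) \<le> distance_ratio (ball 0 1 - {a}) (h x) (h y)"
      using nxy a by (subst img) (auto intro!: ln_mono add_pos_nonneg)
    also have "\<dots> \<le> C * ln 3" using C ball s3 by metis
    also have "1 + 4 * (1 + norm a) / (2 - norm a) = 3 * ((2 + norm a) / (2 - norm a))"
      using a by (simp add: field_simps)
    also have "ln (3 * ((2 + norm a) / (2 - norm a))) = ln 3 + ln ((2 + norm a) / (2 - norm a))"
      using a by (intro ln_mult_pos divide_pos_pos add_pos_nonneg) auto
    also have "\<dots> = lipschitz_bound a * ln 3" by (simp add: lipschitz_bound_def algebra_simps)
    finally show ?thesis by simp
  qed
  ultimately show ?thesis by blast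
qed

end
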